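(* Let $r$ be an integer with $r\geq 2$. If $H$ is an $r$-uniform linear triangle-free (finite) hypergraph, then $$\alpha(H)\geq \sum_{u\in V(H)}f_r(d_H(u)),$$ where $f_r:\mathbb{N}_0\to\mathbb{R}$ is defined recursively by $f_r(0)=1$ and $$f_r(d)=\frac{1+\big((r-1)d^2-d\big)f_r(d-1)}{1+(r-1)d^2}$$ for every positive integer $d$.
   Context: A (finite) hypergraph $H$ is an ordered pair $(V(H),E(H))$, where $V(H)$ is a finite set (the vertices) and $E(H)$ is a set of subsets of $V(H)$ (the edges). The degree $d_H(u)$ of a vertex $u$ is the number of edges of $H$ that contain $u$. $H$ is $r$-uniform if all edges of $H$ have cardinality $r$. $H$ is linear if every two distinct edges of $H$ share at most one vertex. $H$ is triangle-free if there are not three distinct vertices $u_1,u_2,u_3$ of $H$ and three distinct edges $e_1,e_2,e_3$ of $H$ such that $\{u_1,u_2,u_3\}\setminus\{u_i\}\subseteq e_i$ for $i\in\{1,2,3\}$. A set $I$ of vertices of $H$ is (weakly) independent if no edge of $H$ is contained in $I$; the independence number $\alpha(H)$ is the maximum cardinality of an independent set of $H$. $\mathbb{N}_0$ denotes the set of non-negative integers. *)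

theory Defs
  imports Complex_Main
begin

definition hypergraph :: "'a set \<Rightarrow> 'a set set \<Rightarrow> bool" where
  "hypergraph V E \<longleftrightarrow> finite V \<and> E \<subseteq> Pow V"

definition degree :: "'a set set \<Rightarrow> 'a \<Rightarrow> nat" where
  "degree E u = card {e \<in> E. u \<in> e}"

definition uniform :: "nat \<Rightarrow> 'a set set \<Rightarrow> bool" where
  "uniform r E \<longleftrightarrow> (\<forall>e\<in>E. card e = r)"

text \<open>Intersections are finite whenever \<open>hypergraph V E\<close> holds, so \<open>card\<close> has no junk value here.\<close>
definition linear_hypergraph :: "'a set set \<Rightarrow> bool" where
  "linear_hypergraph E \<longleftrightarrow> (\<forall>e\<in>E. \<forall>f\<in>E. e \<noteq> f \<longrightarrow> card (e \<inter> f) \<le> 1)"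

definition triangle_free :: "'a set \<Rightarrow> 'a set set \<Rightarrow> bool" where
  "triangle_free V E \<longleftrightarrow>
     \<not> (\<exists>u1\<in>V. \<exists>u2\<in>V. \<exists>u3\<in>V. \<exists>e1\<in>E. \<exists>e2\<in>E. \<exists>e3\<in>E.
          distinct [u1, u2, u3] \<and> distinct [e1, e2, e3] \<and>
          {u1, u2, u3} - {u1} \<subseteq> e1 \<and>
          {u1, u2, u3} - {u2} \<subseteq> e2 \<and>
          {u1, u2, u3} - {u3} \<subseteq> e3)"

definition independent_set :: "'a set \<Rightarrow> 'a set set \<Rightarrow> 'a set \<Rightarrow> bool" where
  "independent_set V E I \<longleftrightarrow> I \<subseteq> V \<and> \<not> (\<exists>e\<in>E. e \<subseteq> I)"

text \<open>The maximum ranges over a finite set when \<open>V\<close> is finite, and a nonempty one when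
  \<open>{} \<notin> E\<close> (the empty set is then independent), as for \<open>r\<close>-uniform \<open>E\<close> with \<open>r > 0\<close>.\<close>
definition independence_number :: "'a set \<Rightarrow> 'a set set \<Rightarrow> nat" where
  "independence_number V E = Max (card ` {I. independent_set V E I})"

primrec f_seq :: "nat \<Rightarrow> nat \<Rightarrow> real" where
  "f_seq r 0 = 1"
| "f_seq r (Suc d) =
     (1 + ((real r - 1) * (real (Suc d))\<^sup>2 - real (Suc d)) * f_seq r d)
       / (1 + (real r - 1) * (real (Suc d))\<^sup>2)"

end

theory Submission
  imports Defs
begin

text \<open>Pick a vertex \<open>x\<close> and, on each edge \<open>e\<close> through \<open>x\<close>, a second vertex \<open>c e\<close>. Deleting \<open>x\<close>
  and all \<open>c e\<close> together with the edges they meet leaves a hypergraph of the same kind, each of whose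
  independent sets can be enlarged by \<open>x\<close>. A remaining vertex \<open>z\<close> loses at least one edge for every
  deleted \<open>c e\<close> adjacent to it, so, as \<open>f_seq r\<close> is convex and decreasing, the sum over the
  remaining hypergraph is bounded below by an expression that depends on the chosen vertices
  separately, and each \<open>c e\<close> may be taken at least as good as the average over \<open>e - {x}\<close>. Averaging
  over \<open>x\<close> as well, Chebyshev's sum inequality on every edge and the recursion for \<open>f_seq r\<close> show that
  for some \<open>x\<close> the sum drops by at most 1.\<close>

section \<open>Convexity of the recursive sequence\<close>

text \<open>Truncated subtraction gives \<open>f_drop r 0 = 0\<close>, so \<open>f_drop r\<close> is antitone only from 1 on.\<close>

definition f_drop :: "nat \<Rightarrow> nat \<Rightarrow> real" where
  "f_drop r d = f_seq r (d - 1) - f_seq r d"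

text \<open>Clear the denominator and replace \<open>f_seq r (d - 1)\<close> by
  \<open>f_seq r d + f_drop r d\<close>. In this form, multiplied by \<open>real r - 1\<close>, the
  recursion makes the terms of \<open>average_gain\<close> cancel vertex by vertex.\<close>

lemma f_seq_rec:
  assumes "r \<ge> 2"
  shows "1 - f_seq r d - real d * f_seq r d + real d * ((real r - 1) * real d - 1) * f_drop r d = 0"
proof (cases d)
  case (Suc k)
  have "(real r - 1) * (real d)\<^sup>2 \<ge> 0"
    using assms by simp
  then have "1 + (real r - 1) * (real d)\<^sup>2 \<noteq> 0"
    by linarith
  moreover have "f_seq r d = (1 + ((real r - 1) * (real d)\<^sup>2 - real d) * f_seq r k)
       / (1 + (real r - 1) * (real d)\<^sup>2)"
    using Suc by simp
  ultimately have *: "f_seq r d * (1 + (real r - 1) * (real d)\<^sup>2)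
      = 1 + ((real r - 1) * (real d)\<^sup>2 - real d) * f_seq r k"
    by (simp add: nonzero_eq_divide_eq)
  have "f_seq r k = f_seq r d + f_drop r d"
    using Suc by (simp add: f_drop_def)
  with * show ?thesis
    by (simp add: algebra_simps power2_eq_square)
qed simp

text \<open>Eliminating \<open>f_seq\<close> between \<open>f_seq_rec\<close> at \<open>d\<close>
  and at \<open>Suc d\<close> leaves a recursion for the drops alone, on which an induction can
  run.\<close>

lemma f_drop_Suc:
  assumes "r \<ge> 2"
  defines "s \<equiv> real r - 1"
  shows "(real d + 1) * (1 + s * (real d + 1)\<^sup>2) * f_drop r (Suc d)
    = 1 + (real d + 2) * (s * (real d)\<^sup>2 - real d) * f_drop r d"
proof -
  have a: "1 - f_seq r (Suc d) - (real d + 1) * f_seq r (Suc d)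
      + (real d + 1) * (s * (real d + 1) - 1) * f_drop r (Suc d) = 0"
    using f_seq_rec[OF assms(1), of "Suc d"] by (simp add: s_def add.commute)
  have b: "f_seq r (Suc d) = f_seq r d - f_drop r (Suc d)"
    by (simp add: f_drop_def)
  have c: "(real d + 1) * f_seq r d = 1 + real d * (s * real d - 1) * f_drop r d"
    using f_seq_rec[OF assms(1), of d] by (simp add: s_def algebra_simps)
  have "(1 + s * (real d + 1)\<^sup>2) * f_drop r (Suc d) = (real d + 2) * f_seq r d - 1"
    using a unfolding b by (simp add: algebra_simps power2_eq_square)
  then have "(real d + 1) * (1 + s * (real d + 1)\<^sup>2) * f_drop r (Suc d)
      = (real d + 1) * ((real d + 2) * f_seq r d - 1)"
    by (simp only: mult.assoc)
  also have "\<dots> = (real d + 2) * ((real d + 1) * f_seq r d) - (real d + 1)"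
    by (simp add: algebra_simps)
  also have "\<dots> = 1 + (real d + 2) * (s * (real d)\<^sup>2 - real d) * f_drop r d"
    unfolding c by (simp add: algebra_simps power2_eq_square)
  finally show ?thesis .
qed

text \<open>By \<open>f_drop_Suc\<close>, this bound is equivalent to \<open>f_drop r (Suc d) \<le> f_drop r d\<close>.\<close>

lemma f_drop_lower:
  assumes "r \<ge> 2" "d \<ge> 1"
  shows "real r * ((real d)\<^sup>2 + 3 * real d + 1) * f_drop r d \<ge> 1"
  using assms(2)
proof (induction d rule: dec_induct)
  case base
  have "f_drop r 1 = 1 / real r"
    using assms(1) by (simp add: f_drop_def field_simps)
  then show ?case
    using assms(1) by simp
next
  case (step d)
  define s where "s = real r - 1"
  define x where "x = real d"
  define P where "P = x\<^sup>2 + 3 * x + 1"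
  define B where "B = (x + 2) * (s * x\<^sup>2 - x)"
  define A where "A = (x + 1) * (1 + s * (x + 1)\<^sup>2)"
  have s: "s \<ge> 1" and x: "x \<ge> 1"
    using assms(1) step.hyps by (auto simp: s_def x_def)
  have P: "P > 0" and A: "A > 0"
    using s x by (auto simp: P_def A_def intro!: add_pos_nonneg mult_pos_pos)
  \<comment> \<open>The sign of \<open>B\<close> is what allows multiplying the induction hypothesis
    by it.\<close>
  have "(x + 2) * (x * (s * x - 1)) \<ge> 0"
    using s x mult_mono[of 1 s 1 x] by (intro mult_nonneg_nonneg) auto
  then have B: "B \<ge> 0"
    by (simp add: B_def power2_eq_square algebra_simps)
  \<comment> \<open>\<open>A\<close> and \<open>B\<close> are the coefficients in
    \<open>f_drop_Suc\<close>; comparing consecutive drops comes down to their difference.\<close>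
  have AB: "A = B + (s + 1) * P"
    by (simp add: A_def B_def P_def algebra_simps power2_eq_square)
  have IH: "(s + 1) * P * f_drop r d \<ge> 1"
    using step.IH by (simp add: s_def P_def x_def)
  have rec: "A * f_drop r (Suc d) = 1 + B * f_drop r d"
    using f_drop_Suc[OF assms(1), of d] by (simp add: A_def B_def s_def x_def)
  have "A * 1 = B * 1 + (s + 1) * P"
    using AB by simp
  also have "\<dots> \<le> B * ((s + 1) * P * f_drop r d) + (s + 1) * P"
    using B IH by (intro add_right_mono mult_left_mono)
  also have "\<dots> = (s + 1) * P * (1 + B * f_drop r d)"
    by (simp add: algebra_simps)
  also have "\<dots> = A * ((s + 1) * P * f_drop r (Suc d))"
    unfolding rec[symmetric] by (simp only: mult_ac)
  finally have *: "1 \<le> (s + 1) * P * f_drop r (Suc d)"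
    using A by (simp only: mult_le_cancel_left_pos)
  \<comment> \<open>So far the quadratic is the one at \<open>x\<close>; with this sign it can be
    enlarged to the one at \<open>x + 1\<close>.\<close>
  then have "f_drop r (Suc d) \<ge> 0"
    using P s by (smt (verit) mult_nonneg_nonpos mult_pos_pos)
  then have "(s + 1) * P * f_drop r (Suc d)
      \<le> (s + 1) * ((x + 1)\<^sup>2 + 3 * (x + 1) + 1) * f_drop r (Suc d)"
    using s x by (intro mult_right_mono mult_left_mono) (auto simp: P_def power2_eq_square algebra_simps)
  with * show ?case
    by (simp add: s_def x_def add.commute)
qed

lemma f_drop_nonneg:
  assumes "r \<ge> 2"
  shows "f_drop r d \<ge> 0"
proof (cases "d \<ge> 1")
  case True
  have "real r * ((real d)\<^sup>2 + 3 * real d + 1) \<ge> 0"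
    by simp
  with f_drop_lower[OF assms True] show ?thesis
    by (smt (verit) mult_nonneg_nonpos)
next
  case False
  then have "d = 0" by simp
  then show ?thesis by (simp add: f_drop_def)
qed

lemma f_drop_Suc_le:
  assumes "r \<ge> 2" "d \<ge> 1"
  shows "f_drop r (Suc d) \<le> f_drop r d"
proof -
  define s where "s = real r - 1"
  define x where "x = real d"
  have s: "s \<ge> 1" and x: "x \<ge> 1"
    using assms by (auto simp: s_def x_def)
  have A: "(x + 1) * (1 + s * (x + 1)\<^sup>2) > 0"
    using s x by (auto intro!: add_pos_nonneg mult_pos_pos)
  have "(x + 1) * (1 + s * (x + 1)\<^sup>2) * f_drop r (Suc d)
      = 1 + (x + 2) * (s * x\<^sup>2 - x) * f_drop r d"
    using f_drop_Suc[OF assms(1), of d] by (simp add: s_def x_def)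
  also have "\<dots> \<le> (s + 1) * (x\<^sup>2 + 3 * x + 1) * f_drop r d + (x + 2) * (s * x\<^sup>2 - x) * f_drop r d"
    using f_drop_lower[OF assms] by (simp add: s_def x_def)
  also have "\<dots> = (x + 1) * (1 + s * (x + 1)\<^sup>2) * f_drop r d"
    by (simp add: algebra_simps power2_eq_square)
  finally show ?thesis
    using A by (simp only: mult_le_cancel_left_pos)
qed

lemma f_drop_antimono:
  assumes "r \<ge> 2" "1 \<le> a" "a \<le> b"
  shows "f_drop r b \<le> f_drop r a"
  using assms(3,2)
  by (induction b rule: dec_induct) (auto intro: order_trans[OF f_drop_Suc_le[OF assms(1)]])

text \<open>By convexity each of the \<open>k\<close> drops between \<open>d - k\<close> and
  \<open>d\<close> is at least the last one, \<open>f_drop r d\<close>. Later \<open>k\<close>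
  counts the edges lost at a vertex and \<open>m\<close> its deleted neighbors among the chosen
  ones.\<close>

lemma f_seq_diff_ge:
  assumes "r \<ge> 2" "k \<le> d" "m \<le> k"
  shows "f_seq r (d - k) \<ge> f_seq r d + real m * f_drop r d"
proof -
  have "f_seq r (d - k) \<ge> f_seq r d + real k * f_drop r d"
    using assms(2)
  proof (induction k)
    case (Suc k)
    have "f_seq r (d - Suc k) = f_seq r (d - k) + f_drop r (d - k)"
      by (simp add: f_drop_def)
    moreover have "f_drop r (d - k) \<ge> f_drop r d"
      using Suc.prems by (intro f_drop_antimono[OF assms(1)]) auto
    ultimately show ?case
      using Suc by (simp add: algebra_simps)
  qed simp
  moreover have "real m * f_drop r d \<le> real k * f_drop r d"
    using assms by (intro mult_right_mono f_drop_nonneg) auto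
  ultimately show ?thesis by linarith
qed

section \<open>Sums over ordered pairs of vertices of an edge\<close>

lemma sum_offdiag_swap:
  assumes "finite A"
  shows "(\<Sum>x\<in>A. \<Sum>y\<in>A - {x}. h x y) = (\<Sum>x\<in>A. \<Sum>y\<in>A - {x}. h y x)"
proof -
  have *: "A - {x} = {y \<in> A. x \<noteq> y}" for x :: 'a
    by auto
  have "(\<Sum>x\<in>A. \<Sum>y\<in>A - {x}. h x y) = (\<Sum>y\<in>A. \<Sum>x\<in>{x \<in> A. x \<noteq> y}. h x y)"
    unfolding * by (rule sum.swap_restrict[OF assms assms])
  also have "\<dots> = (\<Sum>y\<in>A. \<Sum>x\<in>A - {y}. h x y)"
    unfolding * by (simp only: eq_commute)
  finally show ?thesis .
qed

text \<open>Summed over ordered pairs, the nonnegative products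
  \<open>(p x - p y) * (q y - q x)\<close> give twice the difference of the two sides.\<close>

lemma Chebyshev_offdiag:
  fixes p q :: "'a \<Rightarrow> real"
  assumes "finite A"
    and opp: "\<And>x y. x \<in> A \<Longrightarrow> y \<in> A \<Longrightarrow> (p x - p y) * (q y - q x) \<ge> 0"
  shows "(\<Sum>x\<in>A. \<Sum>y\<in>A - {x}. p x * q x) \<le> (\<Sum>x\<in>A. \<Sum>y\<in>A - {x}. p x * q y)"
proof -
  let ?S = "\<lambda>h :: 'a \<Rightarrow> 'a \<Rightarrow> real. \<Sum>x\<in>A. \<Sum>y\<in>A - {x}. h x y"
  have "0 \<le> ?S (\<lambda>x y. (p x - p y) * (q y - q x))"
    using opp by (intro sum_nonneg) auto
  also have "\<dots> = ?S (\<lambda>x y. p x * q y) - ?S (\<lambda>x y. p x * q x)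
      + (?S (\<lambda>x y. p y * q x) - ?S (\<lambda>x y. p y * q y))"
    by (simp add: algebra_simps sum.distrib sum_subtractf del: sum_constant)
  also have "?S (\<lambda>x y. p y * q x) = ?S (\<lambda>x y. p x * q y)"
    by (rule sum_offdiag_swap[OF assms(1)])
  also have "?S (\<lambda>x y. p y * q y) = ?S (\<lambda>x y. p x * q x)"
    by (rule sum_offdiag_swap[OF assms(1)])
  finally show ?thesis by linarith
qed

section \<open>Linear triangle-free hypergraphs\<close>

definition neighbors :: "'a set set \<Rightarrow> 'a \<Rightarrow> 'a set" where
  "neighbors E x = {y. y \<noteq> x \<and> (\<exists>e\<in>E. x \<in> e \<and> y \<in> e)}"

lemma triangle_free_mono:
  assumes "triangle_free V E" "V' \<subseteq> V" "E' \<subseteq> E"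
  shows "triangle_free V' E'"
  using assms(1) unfolding triangle_free_def
  by (rule contrapos_nn) (elim bexE, intro bexI, assumption, use assms(2,3) in \<open>auto elim: subsetD\<close>)

locale linear_triangle_free =
  fixes r :: nat and V :: "'a set" and E :: "'a set set"
  assumes r2: "r \<ge> 2"
    and hyp: "hypergraph V E"
    and uni: "uniform r E"
    and lin: "linear_hypergraph E"
    and tri: "triangle_free V E"
begin

abbreviation "d \<equiv> degree E"
abbreviation "f \<equiv> f_seq r"
abbreviation "\<Delta> \<equiv> f_drop r"

abbreviation "edges_at x \<equiv> {e \<in> E. x \<in> e}"

lemma finite_V: "finite V" and edge_subset: "e \<in> E \<Longrightarrow> e \<subseteq> V"
  using hyp by (auto simp: hypergraph_def)

lemma finite_E: "finite E"
  using hyp finite_V by (meson finite_Pow_iff finite_subset hypergraph_def)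

lemma finite_edge: "e \<in> E \<Longrightarrow> finite e"
  using edge_subset finite_V finite_subset by blast

lemma card_edge: "e \<in> E \<Longrightarrow> card e = r"
  using uni by (auto simp: uniform_def)

lemma card_edge_minus: "e \<in> E \<Longrightarrow> x \<in> e \<Longrightarrow> real (card (e - {x})) = real r - 1"
  using r2 by (simp add: card_edge finite_edge)

lemma sum_const_edge: "e \<in> edges_at x \<Longrightarrow> (\<Sum>y\<in>e - {x}. k) = (real r - 1) * k"
  using card_edge_minus[of e x] by (simp only: sum_constant mem_Collect_eq)

lemma edge_unique:
  assumes "e \<in> E" "e' \<in> E" "x \<in> e" "y \<in> e" "x \<in> e'" "y \<in> e'" "x \<noteq> y"
  shows "e = e'"
proof (rule ccontr)
  assume "e \<noteq> e'"
  then have "card (e \<inter> e') \<le> 1"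
    using lin assms by (auto simp: linear_hypergraph_def)
  moreover have "card {x, y} \<le> card (e \<inter> e')"
    using assms finite_edge by (intro card_mono) auto
  ultimately show False
    using assms(7) by simp
qed

lemma no_triangle:
  assumes "a \<in> E" "b \<in> E" "e \<in> E" "x \<in> a" "x \<in> b" "y \<in> a" "z \<in> b" "y \<in> e" "z \<in> e"
    and "x \<noteq> y" "x \<noteq> z" "y \<noteq> z" "a \<noteq> b" "e \<noteq> a" "e \<noteq> b"
  shows False
proof -
  have "x \<in> V" "y \<in> V" "z \<in> V"
    using assms edge_subset by blast+
  moreover have "distinct [x, y, z]" "distinct [e, b, a]"
    using assms by auto
  moreover have "{x, y, z} - {x} \<subseteq> e" "{x, y, z} - {y} \<subseteq> b" "{x, y, z} - {z} \<subseteq> a"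
    using assms by auto
  ultimately have "\<exists>u1\<in>V. \<exists>u2\<in>V. \<exists>u3\<in>V. \<exists>e1\<in>E. \<exists>e2\<in>E. \<exists>e3\<in>E.
      distinct [u1, u2, u3] \<and> distinct [e1, e2, e3] \<and> {u1, u2, u3} - {u1} \<subseteq> e1
      \<and> {u1, u2, u3} - {u2} \<subseteq> e2 \<and> {u1, u2, u3} - {u3} \<subseteq> e3"
    using assms(1-3)
    by (intro bexI[of _ x] bexI[of _ y] bexI[of _ z] bexI[of _ e] bexI[of _ b] bexI[of _ a] conjI)
  then show False
    using tri unfolding triangle_free_def by (rule notE[rotated])
qed

text \<open>Keeps the artificial value \<open>f_drop r 0\<close> out of the monotonicity argument in
  \<open>sum_Chebyshev\<close>.\<close>

lemma degree_pos: "e \<in> E \<Longrightarrow> x \<in> e \<Longrightarrow> d x \<ge> 1"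
  using finite_E by (auto simp: degree_def Suc_le_eq card_gt_0_iff)

lemma finite_neighbors: "finite (neighbors E x)"
  using edge_subset by (intro finite_subset[OF _ finite_V]) (auto simp: neighbors_def)

text \<open>By linearity the edges through \<open>x\<close> are pairwise disjoint outside
  \<open>x\<close>, so they partition its neighborhood.\<close>

lemma sum_neighbors: "sum g (neighbors E x) = (\<Sum>e\<in>edges_at x. \<Sum>y\<in>e - {x}. g y)"
proof -
  have "neighbors E x = (\<Union>e\<in>edges_at x. e - {x})"
    by (auto simp: neighbors_def)
  moreover have "sum g (\<Union>e\<in>edges_at x. e - {x}) = (\<Sum>e\<in>edges_at x. \<Sum>y\<in>e - {x}. g y)"
  proof (rule sum.UNION_disjoint)
    show "\<forall>e\<in>edges_at x. \<forall>e'\<in>edges_at x. e \<noteq> e' \<longrightarrow> (e - {x}) \<inter> (e' - {x}) = {}"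
      using edge_unique by blast
  qed (use finite_E finite_edge in auto)
  ultimately show ?thesis by simp
qed

lemma sum_incidence: "(\<Sum>x\<in>V. \<Sum>e\<in>edges_at x. g x e) = (\<Sum>e\<in>E. \<Sum>x\<in>e. g x e)"
proof -
  have "(\<Sum>x\<in>V. \<Sum>e\<in>edges_at x. g x e) = (\<Sum>e\<in>E. \<Sum>x\<in>{x \<in> V. x \<in> e}. g x e)"
    by (rule sum.swap_restrict[OF finite_V finite_E])
  also have "\<dots> = (\<Sum>e\<in>E. \<Sum>x\<in>e. g x e)"
    using edge_subset by (intro sum.cong) auto
  finally show ?thesis .
qed

subsection \<open>Deleting a vertex together with one further vertex on each of its edges\<close>

context
  fixes x :: 'a and c :: "'a set \<Rightarrow> 'a"
  assumes x: "x \<in> V" and choice: "\<forall>e\<in>edges_at x. c e \<in> e - {x}"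
begin

lemma c: "e \<in> edges_at x \<Longrightarrow> c e \<in> e - {x}"
  using choice by blast

definition "Y = c ` edges_at x"
definition "V' = V - insert x Y"
definition "E' = {e \<in> E. e \<inter> insert x Y = {}}"

lemma inj_c: "inj_on c (edges_at x)"
proof (rule inj_onI)
  fix a b assume *: "a \<in> edges_at x" "b \<in> edges_at x" "c a = c b"
  then show "a = b"
    using edge_unique[of a b x "c a"] c[of a] c[of b] by auto
qed

lemma finite_Y: "finite Y"
  using finite_E by (simp add: Y_def)

lemma Y_subset: "Y \<subseteq> V"
  using c edge_subset by (fastforce simp: Y_def)

lemma x_notin_Y: "x \<notin> Y"
  using c by (fastforce simp: Y_def)

text \<open>This is where triangle-freeness enters: an edge avoiding \<open>x\<close> with two
  chosen vertices would close a triangle with \<open>x\<close>. If the edge contains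
  \<open>x\<close>, linearity identifies it with both edges for which the vertices were
  chosen.\<close>

lemma Y_edge_unique:
  assumes "e \<in> E" "y \<in> e" "y' \<in> e" "y \<in> Y" "y' \<in> Y"
  shows "y = y'"
proof (rule ccontr)
  assume ne: "y \<noteq> y'"
  obtain a b where a: "a \<in> edges_at x" "y = c a" and b: "b \<in> edges_at x" "y' = c b"
    using assms by (auto simp: Y_def)
  have ya: "y \<in> a" "y \<noteq> x" and yb: "y' \<in> b" "y' \<noteq> x"
    using a b c by auto
  have "a \<noteq> b"
    using a b ne by auto
  show False
  proof (cases "x \<in> e")
    case True
    then show False
      using edge_unique[of e a x y] edge_unique[of e b x y'] a b ya yb assms \<open>a \<noteq> b\<close> by auto
  next
    case False
    then show False
      using no_triangle[of a b e x y y'] a b ya yb assms \<open>a \<noteq> b\<close> ne by auto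
  qed
qed

lemma card_Y_edge: "e \<in> E \<Longrightarrow> card (e \<inter> Y) \<le> 1"
  using Y_edge_unique finite_edge by (auto simp: card_le_Suc0_iff_eq)

lemma linear_triangle_free_deletion: "linear_triangle_free r V' E'"
proof
  show "hypergraph V' E'"
    using finite_V edge_subset by (auto simp: hypergraph_def V'_def E'_def)
  show "uniform r E'" "linear_hypergraph E'"
    using uni lin by (auto simp: uniform_def linear_hypergraph_def E'_def)
  show "triangle_free V' E'"
    by (rule triangle_free_mono[OF tri]) (auto simp: V'_def E'_def)
qed (rule r2)

text \<open>An edge through \<open>x\<close> contains its chosen vertex, which was deleted; any
  other edge inside the enlarged set avoids all deleted vertices and so survives in
  \<open>E'\<close>.\<close>

lemma independent_set_insert:
  assumes "independent_set V' E' I"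
  shows "independent_set V E (insert x I)"
proof -
  have I: "I \<subseteq> V'" "\<not> (\<exists>e\<in>E'. e \<subseteq> I)"
    using assms by (auto simp: independent_set_def)
  have False if e: "e \<in> E" "e \<subseteq> insert x I" for e
  proof (cases "x \<in> e")
    case True
    then have "c e \<in> e - {x}" "c e \<in> Y"
      using c e by (auto simp: Y_def)
    then show False
      using e I by (auto simp: V'_def)
  next
    case False
    then have "e \<in> E'" "e \<subseteq> I"
      using e I by (auto simp: E'_def V'_def)
    then show False
      using I by auto
  qed
  then show ?thesis
    using I x by (auto simp: independent_set_def V'_def)
qed

text \<open>Every chosen neighbor of \<open>z\<close> lies on an edge that \<open>z\<close> loses,
  and by \<open>card_Y_edge\<close> no edge carries two of them, so \<open>z\<close> loses at least
  as many edges as it has chosen neighbors.\<close>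

lemma f_degree_deletion:
  assumes "z \<in> V'"
  shows "f (degree E' z) \<ge> f (d z) + real (card {y \<in> Y. z \<in> neighbors E y}) * \<Delta> (d z)"
proof -
  define L where "L = {e \<in> edges_at z. e \<inter> insert x Y \<noteq> {}}"
  have fin: "finite L"
    using finite_E by (simp add: L_def)
  have "edges_at z - L = {e \<in> E'. z \<in> e}"
    by (auto simp: L_def E'_def)
  then have deg: "degree E' z = d z - card L"
    using card_Diff_subset[OF fin, of "edges_at z"] by (auto simp: degree_def L_def)
  have "{y \<in> Y. z \<in> neighbors E y} \<subseteq> (\<Union>e\<in>L. e \<inter> Y)"
    by (auto simp: neighbors_def L_def)
  then have "card {y \<in> Y. z \<in> neighbors E y} \<le> card (\<Union>e\<in>L. e \<inter> Y)"
    using fin finite_Y by (intro card_mono) auto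
  also have "\<dots> \<le> (\<Sum>e\<in>L. card (e \<inter> Y))"
    by (rule card_UN_le[OF fin])
  also have "\<dots> \<le> of_nat (card L) * 1"
    by (rule sum_bounded_above) (use card_Y_edge in \<open>simp add: L_def\<close>)
  finally have "card {y \<in> Y. z \<in> neighbors E y} \<le> card L"
    by simp
  moreover have "card L \<le> d z"
    using finite_E unfolding degree_def by (intro card_mono) (auto simp: L_def)
  ultimately show ?thesis
    unfolding deg by (intro f_seq_diff_ge[OF r2])
qed

text \<open>Two chosen vertices are never adjacent, so \<open>x\<close> is the only deleted neighbor
  of \<open>y\<close>.\<close>

lemma neighbors_minus:
  assumes "y \<in> Y"
  shows "{z \<in> V'. z \<in> neighbors E y} = neighbors E y - {x}"
  using assms edge_subset Y_edge_unique by (fastforce simp: neighbors_def V'_def)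

lemma sum_deletion:
  "(\<Sum>z\<in>V'. f (degree E' z)) \<ge> (\<Sum>z\<in>V. f (d z)) - f (d x)
     + (\<Sum>e\<in>edges_at x. (\<Sum>z\<in>neighbors E (c e) - {x}. \<Delta> (d z)) - f (d (c e)))"
proof -
  have fin: "finite V'"
    using finite_V by (simp add: V'_def)
  \<comment> \<open>Counting adjacent pairs from the side of \<open>y\<close> separates the
    contributions of the chosen vertices.\<close>
  have "(\<Sum>z\<in>V'. real (card {y \<in> Y. z \<in> neighbors E y}) * \<Delta> (d z))
      = (\<Sum>z\<in>V'. \<Sum>y\<in>{y \<in> Y. z \<in> neighbors E y}. \<Delta> (d z))"
    by simp
  also have "\<dots> = (\<Sum>y\<in>Y. \<Sum>z\<in>{z \<in> V'. z \<in> neighbors E y}. \<Delta> (d z))"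
    by (rule sum.swap_restrict[OF fin finite_Y])
  also have "\<dots> = (\<Sum>y\<in>Y. \<Sum>z\<in>neighbors E y - {x}. \<Delta> (d z))"
    by (intro sum.cong refl) (simp add: neighbors_minus)
  finally have *: "(\<Sum>z\<in>V'. real (card {y \<in> Y. z \<in> neighbors E y}) * \<Delta> (d z))
      = (\<Sum>y\<in>Y. \<Sum>z\<in>neighbors E y - {x}. \<Delta> (d z))" .
  have "(\<Sum>z\<in>V'. f (d z)) = (\<Sum>z\<in>V. f (d z)) - (\<Sum>z\<in>insert x Y. f (d z))"
    unfolding V'_def using finite_V x Y_subset by (intro sum_diff) auto
  also have "(\<Sum>z\<in>insert x Y. f (d z)) = f (d x) + (\<Sum>y\<in>Y. f (d y))"
    using finite_Y x_notin_Y by simp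
  finally have "(\<Sum>z\<in>V. f (d z)) - f (d x)
      + (\<Sum>y\<in>Y. (\<Sum>z\<in>neighbors E y - {x}. \<Delta> (d z)) - f (d y))
      = (\<Sum>z\<in>V'. f (d z) + real (card {y \<in> Y. z \<in> neighbors E y}) * \<Delta> (d z))"
    using * by (simp add: sum.distrib sum_subtractf)
  also have "\<dots> \<le> (\<Sum>z\<in>V'. f (degree E' z))"
    by (intro sum_mono f_degree_deletion)
  finally show ?thesis
    by (simp add: Y_def sum.reindex[OF inj_c] o_def)
qed

end

subsection \<open>Averaging\<close>

text \<open>On each edge \<open>s * real (d y) - 1\<close> grows with the degree while
  \<open>\<Delta> (d y)\<close> shrinks, so pairing opposite vertices gives at least as much as
  pairing each with itself. Each vertex is paired \<open>s * real (d y)\<close> times.\<close>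

lemma sum_Chebyshev:
  defines "s \<equiv> real r - 1"
  shows "(\<Sum>y\<in>V. (s * real (d y) - 1) * (\<Sum>z\<in>neighbors E y. \<Delta> (d z)))
    \<ge> (\<Sum>y\<in>V. s * real (d y) * (s * real (d y) - 1) * \<Delta> (d y))"
proof -
  let ?p = "\<lambda>y. s * real (d y) - 1"
  have s: "s \<ge> 0"
    using r2 by (simp add: s_def)
  have "(\<Sum>y\<in>V. s * real (d y) * ?p y * \<Delta> (d y))
      = (\<Sum>y\<in>V. \<Sum>e\<in>edges_at y. \<Sum>z\<in>e - {y}. ?p y * \<Delta> (d y))"
  proof (rule sum.cong[OF refl])
    fix y
    have "(\<Sum>e\<in>edges_at y. \<Sum>z\<in>e - {y}. ?p y * \<Delta> (d y)) = (\<Sum>e\<in>edges_at y. s * (?p y * \<Delta> (d y)))"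
      by (intro sum.cong refl) (simp only: sum_const_edge s_def)
    then show "s * real (d y) * ?p y * \<Delta> (d y) = (\<Sum>e\<in>edges_at y. \<Sum>z\<in>e - {y}. ?p y * \<Delta> (d y))"
      by (simp add: degree_def)
  qed
  also have "\<dots> = (\<Sum>e\<in>E. \<Sum>y\<in>e. \<Sum>z\<in>e - {y}. ?p y * \<Delta> (d y))"
    by (rule sum_incidence)
  also have "\<dots> \<le> (\<Sum>e\<in>E. \<Sum>y\<in>e. \<Sum>z\<in>e - {y}. ?p y * \<Delta> (d z))"
  proof (rule sum_mono, rule Chebyshev_offdiag, rule finite_edge)
    fix e y z assume e: "e \<in> E" "y \<in> e" "z \<in> e"
    show "(?p y - ?p z) * (\<Delta> (d z) - \<Delta> (d y)) \<ge> 0"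
    proof (cases "d y \<le> d z")
      case True
      then have "?p y \<le> ?p z" "\<Delta> (d z) \<le> \<Delta> (d y)"
        using s e degree_pos by (auto intro!: mult_left_mono f_drop_antimono[OF r2])
      then show ?thesis
        by (intro mult_nonpos_nonpos) auto
    next
      case False
      then have "?p z \<le> ?p y" "\<Delta> (d y) \<le> \<Delta> (d z)"
        using s e degree_pos by (auto intro!: mult_left_mono f_drop_antimono[OF r2])
      then show ?thesis
        by (intro mult_nonneg_nonneg) auto
    qed
  qed
  also have "\<dots> = (\<Sum>y\<in>V. \<Sum>e\<in>edges_at y. \<Sum>z\<in>e - {y}. ?p y * \<Delta> (d z))"
    by (rule sum_incidence[symmetric])
  also have "\<dots> = (\<Sum>y\<in>V. ?p y * (\<Sum>z\<in>neighbors E y. \<Delta> (d z)))"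
    by (simp add: sum_neighbors sum_distrib_left)
  finally show ?thesis .
qed

text \<open>The factor \<open>s\<close> is the size of \<open>e - {x}\<close>, so this is
  \<open>s\<close> times the gain with each choice replaced by its mean, summed over all
  \<open>x\<close>.\<close>

lemma average_gain:
  defines "s \<equiv> real r - 1"
  shows "(\<Sum>x\<in>V. s * (1 - f (d x)) + (\<Sum>e\<in>edges_at x. \<Sum>y\<in>e - {x}.
           (\<Sum>z\<in>neighbors E y - {x}. \<Delta> (d z)) - f (d y))) \<ge> 0"
proof -
  let ?S = "\<lambda>y. \<Sum>z\<in>neighbors E y. \<Delta> (d z)"
  \<comment> \<open>Here \<open>x\<close> is itself a neighbor of \<open>y\<close>, so leaving it
    out costs \<open>\<Delta> (d x)\<close>.\<close>
  have "(\<Sum>x\<in>V. \<Sum>e\<in>edges_at x. \<Sum>y\<in>e - {x}. (\<Sum>z\<in>neighbors E y - {x}. \<Delta> (d z)) - f (d y))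
      = (\<Sum>x\<in>V. \<Sum>e\<in>edges_at x. \<Sum>y\<in>e - {x}. ?S y - \<Delta> (d x) - f (d y))"
    using finite_neighbors by (intro sum.cong refl) (auto simp: sum_diff1 neighbors_def)
  also have "\<dots> = (\<Sum>e\<in>E. \<Sum>x\<in>e. \<Sum>y\<in>e - {x}. ?S y - \<Delta> (d x) - f (d y))"
    by (rule sum_incidence)
  \<comment> \<open>With \<open>y\<close> outside, \<open>?S y\<close> occurs
    \<open>s * real (d y)\<close> times and the terms \<open>\<Delta> (d x)\<close> add up to one
    further \<open>?S y\<close>, subtracted.\<close>
  also have "\<dots> = (\<Sum>e\<in>E. \<Sum>y\<in>e. \<Sum>x\<in>e - {y}. ?S y - \<Delta> (d x) - f (d y))"
    using finite_edge by (intro sum.cong refl sum_offdiag_swap)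
  also have "\<dots> = (\<Sum>y\<in>V. \<Sum>e\<in>edges_at y. \<Sum>x\<in>e - {y}. ?S y - \<Delta> (d x) - f (d y))"
    by (rule sum_incidence[symmetric])
  also have "\<dots> = (\<Sum>y\<in>V. (s * real (d y) - 1) * ?S y - s * real (d y) * f (d y))"
  proof (rule sum.cong[OF refl])
    fix y
    have "(\<Sum>e\<in>edges_at y. \<Sum>x\<in>e - {y}. ?S y - \<Delta> (d x) - f (d y))
        = (\<Sum>e\<in>edges_at y. s * (?S y - f (d y)) - (\<Sum>x\<in>e - {y}. \<Delta> (d x)))"
      by (intro sum.cong refl) (simp only: sum_subtractf sum_const_edge s_def, simp add: algebra_simps)
    also have "\<dots> = real (d y) * (s * (?S y - f (d y))) - ?S y"
      by (simp add: sum_subtractf sum_neighbors degree_def)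
    finally show "(\<Sum>e\<in>edges_at y. \<Sum>x\<in>e - {y}. ?S y - \<Delta> (d x) - f (d y))
        = (s * real (d y) - 1) * ?S y - s * real (d y) * f (d y)"
      by (simp add: algebra_simps)
  qed
  also have "\<dots> \<ge> (\<Sum>y\<in>V. s * real (d y) * (s * real (d y) - 1) * \<Delta> (d y) - s * real (d y) * f (d y))"
    using sum_Chebyshev by (simp add: s_def sum_subtractf)
  also have "(\<Sum>y\<in>V. s * real (d y) * (s * real (d y) - 1) * \<Delta> (d y) - s * real (d y) * f (d y))
      = (\<Sum>y\<in>V. - (s * (1 - f (d y))))"
  proof (rule sum.cong[OF refl])
    fix y
    have "s * (1 - f (d y) - real (d y) * f (d y) + real (d y) * (s * real (d y) - 1) * \<Delta> (d y)) = 0"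
      using f_seq_rec[OF r2, of "d y"] by (simp add: s_def)
    then show "s * real (d y) * (s * real (d y) - 1) * \<Delta> (d y) - s * real (d y) * f (d y)
        = - (s * (1 - f (d y)))"
      by (simp add: algebra_simps)
  qed
  finally show ?thesis
    by (simp add: sum.distrib sum_negf)
qed

text \<open>Some \<open>x\<close> has a nonnegative term in \<open>average_gain\<close>, and on each
  edge through it some vertex reaches the mean of \<open>\<phi> x\<close>. The last property says
  that the bound in \<open>sum_deletion\<close> is at least the old sum minus 1.\<close>

lemma exists_good_deletion:
  assumes "V \<noteq> {}"
  obtains x c where "x \<in> V" "\<forall>e\<in>edges_at x. c e \<in> e - {x}"
    "1 - f (d x) + (\<Sum>e\<in>edges_at x. (\<Sum>z\<in>neighbors E (c e) - {x}. \<Delta> (d z)) - f (d (c e))) \<ge> 0"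
proof -
  define s where "s = real r - 1"
  have s: "s > 0"
    using r2 by (simp add: s_def)
  define \<phi> where "\<phi> = (\<lambda>x y. (\<Sum>z\<in>neighbors E y - {x}. \<Delta> (d z)) - f (d y))"
  have "\<exists>x\<in>V. s * (1 - f (d x)) + (\<Sum>e\<in>edges_at x. \<Sum>y\<in>e - {x}. \<phi> x y) \<ge> 0"
  proof (rule ccontr)
    assume "\<not> ?thesis"
    then have "(\<Sum>x\<in>V. s * (1 - f (d x)) + (\<Sum>e\<in>edges_at x. \<Sum>y\<in>e - {x}. \<phi> x y)) < (\<Sum>x\<in>V. 0)"
      using finite_V assms by (intro sum_strict_mono) (auto simp: not_le)
    then show False
      using average_gain by (simp add: s_def \<phi>_def)
  qed
  then obtain x where x: "x \<in> V"
    and gain: "s * (1 - f (d x)) + (\<Sum>e\<in>edges_at x. \<Sum>y\<in>e - {x}. \<phi> x y) \<ge> 0"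
    by blast
  have "\<exists>y\<in>e - {x}. (\<Sum>y\<in>e - {x}. \<phi> x y) \<le> s * \<phi> x y" if "e \<in> edges_at x" for e
  proof (rule ccontr)
    have card: "real (card (e - {x})) = s" and fin: "finite (e - {x})"
      using that card_edge_minus finite_edge by (auto simp: s_def)
    have ne: "e - {x} \<noteq> {}"
      using card s by (metis card.empty less_irrefl of_nat_0)
    assume "\<not> ?thesis"
    \<comment> \<open>The right side adds a constant \<open>s\<close> times, so both sides are
      \<open>s\<close> times the same sum, which contradicts strictness.\<close>
    then have "(\<Sum>y\<in>e - {x}. s * \<phi> x y) < (\<Sum>y\<in>e - {x}. \<Sum>y\<in>e - {x}. \<phi> x y)"
      using fin ne by (intro sum_strict_mono) (auto simp only: not_le bex_simps)
    then show False
      using card by (simp flip: sum_distrib_left)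
  qed
  then obtain c where c: "\<forall>e\<in>edges_at x. c e \<in> e - {x}"
    and le: "\<And>e. e \<in> edges_at x \<Longrightarrow> (\<Sum>y\<in>e - {x}. \<phi> x y) \<le> s * \<phi> x (c e)"
    by metis
  have "(\<Sum>e\<in>edges_at x. \<Sum>y\<in>e - {x}. \<phi> x y) \<le> (\<Sum>e\<in>edges_at x. s * \<phi> x (c e))"
    by (rule sum_mono, rule le)
  with gain have "0 \<le> s * (1 - f (d x)) + (\<Sum>e\<in>edges_at x. s * \<phi> x (c e))"
    by linarith
  also have "\<dots> = s * (1 - f (d x) + (\<Sum>e\<in>edges_at x. \<phi> x (c e)))"
    by (simp add: sum_distrib_left algebra_simps)
  finally have "1 - f (d x) + (\<Sum>e\<in>edges_at x. \<phi> x (c e)) \<ge> 0"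
    using s by (simp add: zero_le_mult_iff)
  with x c show thesis
    using that unfolding \<phi>_def by blast
qed

end

section \<open>Induction on the number of vertices\<close>

lemma exists_large_independent_set:
  assumes "linear_triangle_free r V E"
  shows "\<exists>I. independent_set V E I \<and> real (card I) \<ge> (\<Sum>u\<in>V. f_seq r (degree E u))"
  using assms
proof (induction "card V" arbitrary: V E rule: less_induct)
  case less
  interpret linear_triangle_free r V E
    by (rule less.prems)
  show ?case
  proof (cases "V = {}")
    case True
    \<comment> \<open>Edges have \<open>r\<close> \<ge> 2 vertices, so none lies in the empty
      set.\<close>
    have "independent_set V E {}"
      using card_edge[of "{}"] r2 by (auto simp: independent_set_def)
    then show ?thesis
      using True by (intro exI[of _ "{}"]) simp
  next
    case False
    obtain x c where x: "x \<in> V" and c: "\<forall>e\<in>edges_at x. c e \<in> e - {x}"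
      and gain: "1 - f (d x)
        + (\<Sum>e\<in>edges_at x. (\<Sum>z\<in>neighbors E (c e) - {x}. \<Delta> (d z)) - f (d (c e))) \<ge> 0"
      by (rule exists_good_deletion[OF False]) blast
    let ?V = "V' x c" and ?E = "E' x c"
    have V: "?V \<subseteq> V - {x}"
      by (auto simp: V'_def[OF x c])
    then have "card ?V < card V"
      using x finite_V by (intro psubset_card_mono) auto
    then obtain I where I: "independent_set ?V ?E I"
      and large: "real (card I) \<ge> (\<Sum>u\<in>?V. f (degree ?E u))"
      using less.hyps linear_triangle_free_deletion[OF x c] by blast
    have "I \<subseteq> V - {x}"
      using I V by (auto simp: independent_set_def)
    then have "card (insert x I) = Suc (card I)"
      using finite_V by (intro card_insert_disjoint) (auto dest: finite_subset)
    moreover have "independent_set V E (insert x I)"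
      by (rule independent_set_insert[OF x c I])
    \<comment> \<open>Adding \<open>x\<close> enlarges the independent set by 1, which pays for the
      loss of at most 1 in the degree sum.\<close>
    ultimately show ?thesis
      using large gain sum_deletion[OF x c] by (intro exI[of _ "insert x I"]) simp
  qed
qed

theorem theorem4:
  fixes r :: nat and V :: "'a set" and E :: "'a set set"
  assumes "r \<ge> 2"
    and "hypergraph V E"
    and "uniform r E"
    and "linear_hypergraph E"
    and "triangle_free V E"
  shows "real (independence_number V E) \<ge> (\<Sum>u\<in>V. f_seq r (degree E u))"
proof -
  have "linear_triangle_free r V E"
    using assms by (simp add: linear_triangle_free_def)
  then obtain I where I: "independent_set V E I"
    and large: "real (card I) \<ge> (\<Sum>u\<in>V. f_seq r (degree E u))"
    using exists_large_independent_set by blast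
  have "finite {I. independent_set V E I}"
    using assms(2) by (auto simp: independent_set_def hypergraph_def intro: finite_subset[of _ "Pow V"])
  then have "card I \<le> independence_number V E"
    using I unfolding independence_number_def by (intro Max_ge) auto
  with large show ?thesis by linarith
qed

end
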